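(* Let $X$ be a Banach space, let $Y$ be an $M$-summand in $X$, and let $Z$ be a closed linear subspace of $Y$. If $(Y,Z,\mathcal{CB}(Y))$ has property-$(P_1)$, then $(X,Z,\mathcal{CB}(X))$ has property-$(P_1)$.
   Context: All Banach spaces are real and subspaces are closed and linear. A subspace $J$ of $X$ is an $M$-summand in $X$ if there is a linear projection $P:X\to X$ with range $J$ such that $\|x\|=\max\{\|Px\|,\|x-Px\|\}$ for each $x\in X$. For a Banach space $E$, $B_E$ is its closed unit ball and $\mathcal{CB}(E)$ is the class of non-empty closed bounded subsets of $E$. For $v\in E$ and a non-empty bounded set $F\subseteq E$, $r(v,F)=\sup_{z\in F}\|v-z\|$. For a non-empty closed convex $V\subseteq E$: $\mathrm{rad}_V(F)=\inf_{v\in V}r(v,F)$, $\mathrm{cent}_V(F)=\{v\in V: r(v,F)=\mathrm{rad}_V(F)\}$, and for $\delta>0$, $\mathrm{cent}_V(F,\delta)=\{v\in V: r(v,F)\le \mathrm{rad}_V(F)+\delta\}$. For $\mathscr F\subseteq\mathcal{CB}(E)$, the pair $(V,\mathscr F)$ has the restricted center property (r.c.p.) if $\mathrm{cent}_V(F)\ne\emptyset$ for every $F\in\mathscr F$. The triplet $(E,V,\mathscr F)$ has property-$(P_1)$ if $(V,\mathscr F)$ has r.c.p. and for every $\varepsilon>0$ and $F\in\mathscr F$ there is $\delta>0$ with $\mathrm{cent}_V(F,\delta)\subseteq\mathrm{cent}_V(F)+\varepsilon B_E$. *)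

theory Defs
  imports "HOL-Analysis.Analysis"
begin

text \<open>
  A Banach space \<open>E\<close> is given as a closed linear subspace \<open>E\<close> of a type of class
  \<^class>\<open>banach\<close>, with the inherited norm; the whole type is \<open>E = UNIV\<close>.
\<close>

definition closed_subspace :: "'a::real_normed_vector set \<Rightarrow> bool" where
  "closed_subspace J \<longleftrightarrow> subspace J \<and> closed J"

definition M_summand :: "'a::real_normed_vector set \<Rightarrow> bool" where
  "M_summand J \<longleftrightarrow> closed_subspace J \<and>
     (\<exists>P. linear P \<and> P \<circ> P = P \<and> range P = J \<and>
          (\<forall>x. norm x = max (norm (P x)) (norm (x - P x))))"

definition unit_ball :: "'a::real_normed_vector set \<Rightarrow> 'a set" where
  "unit_ball E = {x \<in> E. norm x \<le> 1}"

text \<open>Since \<open>E\<close> is closed, a subset of \<open>E\<close> is closed in \<open>E\<close> iff it is closed in the whole type.\<close>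

definition CB :: "'a::real_normed_vector set \<Rightarrow> 'a set set" where
  "CB E = {F. F \<subseteq> E \<and> F \<noteq> {} \<and> closed F \<and> bounded F}"

text \<open>
  The suprema and infima below are taken in the conditionally complete order of the reals, so these
  notions are meaningful only for \<open>F\<close> non-empty and bounded and \<open>V\<close> non-empty (and, as usual,
  closed and convex).
\<close>

definition radius_at :: "'a::real_normed_vector \<Rightarrow> 'a set \<Rightarrow> real" where
  "radius_at v F = (SUP z\<in>F. norm (v - z))"

definition rad :: "'a::real_normed_vector set \<Rightarrow> 'a set \<Rightarrow> real" where
  "rad V F = (INF v\<in>V. radius_at v F)"

definition cent :: "'a::real_normed_vector set \<Rightarrow> 'a set \<Rightarrow> 'a set" where
  "cent V F = {v \<in> V. radius_at v F = rad V F}"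

definition near_cent :: "'a::real_normed_vector set \<Rightarrow> 'a set \<Rightarrow> real \<Rightarrow> 'a set" where
  "near_cent V F \<delta> = {v \<in> V. radius_at v F \<le> rad V F + \<delta>}"

definition rcp :: "'a::real_normed_vector set \<Rightarrow> 'a set set \<Rightarrow> bool" where
  "rcp V \<F> \<longleftrightarrow> (\<forall>F\<in>\<F>. cent V F \<noteq> {})"

text \<open>Intended for \<open>V \<subseteq> E\<close> and \<open>\<F> \<subseteq> CB E\<close>.\<close>

definition property_P1 :: "'a::real_normed_vector set \<Rightarrow> 'a set \<Rightarrow> 'a set set \<Rightarrow> bool" where
  "property_P1 E V \<F> \<longleftrightarrow> rcp V \<F> \<and>
     (\<forall>\<epsilon>>0. \<forall>F\<in>\<F>. \<exists>\<delta>>0.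
        near_cent V F \<delta> \<subseteq> {c + \<epsilon> *\<^sub>R b | c b. c \<in> cent V F \<and> b \<in> unit_ball E})"

end

theory Submission
  imports Defs
begin

text \<open>
  Let \<open>P\<close> be the \<open>M\<close>-projection onto \<open>Y\<close>, let \<open>G\<close> be the closure of \<open>P ` F\<close> and let
  \<open>s = sup {norm (z - P z) | z \<in> F}\<close>. For \<open>v \<in> Y\<close> the \<open>M\<close>-summand identity gives
  \<open>r(v, F) = max (r(v, G)) s\<close>, hence \<open>rad(F) = max (rad(G)) s\<close>. If \<open>s \<le> rad(G)\<close>, then \<open>F\<close> has the
  centers of \<open>G\<close> and its near-centers are near-centers of \<open>G\<close>. If \<open>s > rad(G)\<close>, then the centers of
  \<open>F\<close> form the sublevel set \<open>r(\<cdot>, G) \<le> s\<close> of a convex function above its attained minimum, and such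
  sublevel sets vary continuously: a slightly larger one is pulled back into it by
  moving towards a center of \<open>G\<close>.
\<close>

text \<open>Turns the supremum into a containment in a ball. Two radii can then be proved equal by
  showing that they have the same upper bounds.\<close>

lemma radius_at_le_iff:
  assumes "F \<noteq> {}" and "bounded F"
  shows "radius_at v F \<le> a \<longleftrightarrow> F \<subseteq> cball v a"
proof -
  obtain B where "\<And>z. z \<in> F \<Longrightarrow> norm (v - z) \<le> B"
    using bounded_any_center[of F v] assms(2) by (auto simp: dist_norm)
  then have "bdd_above ((\<lambda>z. norm (v - z)) ` F)"
    by (meson bdd_aboveI2)
  then show ?thesis
    unfolding radius_at_def
    by (subst cSUP_le_iff) (use assms(1) in \<open>auto simp: dist_norm\<close>)
qed

lemma norm_diff_le_radius_at:
  assumes "bounded F" and "z \<in> F"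
  shows "norm (v - z) \<le> radius_at v F"
proof -
  have "F \<subseteq> cball v (radius_at v F)"
    using assms radius_at_le_iff[of F v "radius_at v F"] by blast
  then show ?thesis
    using assms(2) by (auto simp: dist_norm)
qed

lemma radius_at_nonneg:
  assumes "F \<noteq> {}" and "bounded F"
  shows "0 \<le> radius_at v F"
  using assms norm_diff_le_radius_at[of F _ v] norm_ge_zero order_trans by blast

text \<open>A closed ball that contains \<open>F\<close> contains its closure. This allows the image
  of a set under the projection, which need not be closed, to be replaced by a member of
  \<open>CB Y\<close>.\<close>

lemma radius_at_closure:
  assumes "F \<noteq> {}" and "bounded F"
  shows "radius_at v (closure F) = radius_at v F"
proof -
  have "radius_at v (closure F) \<le> a \<longleftrightarrow> radius_at v F \<le> a" for a
  proof -
    have "closure F \<subseteq> cball v a \<longleftrightarrow> F \<subseteq> cball v a"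
      using closure_subset closure_minimal closed_cball by blast
    then show ?thesis
      using assms by (simp add: radius_at_le_iff bounded_closure)
  qed
  then show ?thesis
    by (meson order.antisym order.refl)
qed

lemma rad_le_radius_at:
  assumes "F \<noteq> {}" and "bounded F" and "v \<in> V"
  shows "rad V F \<le> radius_at v F"
  unfolding rad_def
  by (rule cINF_lower) (use assms radius_at_nonneg in \<open>auto intro!: bdd_belowI2\<close>)

lemma radius_at_convex_combination:
  assumes "F \<noteq> {}" and "bounded F" and "0 \<le> t" and "t \<le> 1"
  shows "radius_at ((1 - t) *\<^sub>R v + t *\<^sub>R c) F \<le> (1 - t) * radius_at v F + t * radius_at c F"
proof -
  have "norm ((1 - t) *\<^sub>R v + t *\<^sub>R c - z) \<le> (1 - t) * radius_at v F + t * radius_at c F"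
    if "z \<in> F" for z
  proof -
    have "(1 - t) *\<^sub>R v + t *\<^sub>R c - z = (1 - t) *\<^sub>R (v - z) + t *\<^sub>R (c - z)"
      by (simp add: algebra_simps)
    also have "norm \<dots> \<le> (1 - t) * norm (v - z) + t * norm (c - z)"
      using norm_triangle_ineq[of "(1 - t) *\<^sub>R (v - z)" "t *\<^sub>R (c - z)"] assms(3,4) by simp
    also have "\<dots> \<le> (1 - t) * radius_at v F + t * radius_at c F"
      using assms that by (intro add_mono mult_left_mono norm_diff_le_radius_at) auto
    finally show ?thesis .
  qed
  then show ?thesis
    using assms(1,2) by (auto simp: radius_at_le_iff dist_norm)
qed

text \<open>Moving \<open>v\<close> by a fraction \<open>t\<close> towards \<open>c\<close> lowers
  the bound on the radius linearly, because \<open>radius_at\<close> is convex, and costs a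
  displacement \<open>t * norm (v - c)\<close>. As \<open>rad V G\<close> lies strictly below
  \<open>s\<close>, a small \<open>t\<close> suffices.\<close>

lemma sublevel_radius_at_continuous:
  assumes "convex V" and G: "G \<noteq> {}" "bounded G" and c: "c \<in> cent V G"
    and "rad V G < s" and "0 < \<epsilon>"
  shows "\<exists>\<delta>>0. \<forall>v\<in>V. radius_at v G \<le> s + \<delta> \<longrightarrow>
           (\<exists>w\<in>V. radius_at w G \<le> s \<and> norm (v - w) \<le> \<epsilon>)"
proof -
  define R where "R = rad V G"
  have cV: "c \<in> V" and cR: "radius_at c G = R"
    using c by (auto simp: cent_def R_def)
  have R: "0 \<le> R" "R < s"
    using radius_at_nonneg[OF G, of c] cR assms(5) by (auto simp: R_def)
  \<comment> \<open>With \<open>\<delta> \<le> s\<close>, going through a point of \<open>G\<close>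
    gives \<open>norm (v - c) \<le> (s + \<delta>) + R \<le> 3 * s\<close>. The second bound then
    keeps the displacement at most \<open>\<epsilon>\<close>.\<close>
  define \<delta> where "\<delta> = min s (\<epsilon> * (s - R) / (3 * s))"
  have \<delta>: "0 < \<delta>" "\<delta> \<le> s" "\<delta> * (3 * s) \<le> \<epsilon> * (s - R)"
    using R assms(6) by (auto simp: \<delta>_def min_def field_simps)
  \<comment> \<open>The solution of \<open>(1 - t) * (s + \<delta>) + t * R = s\<close>.\<close>
  define t where "t = \<delta> / (s - R + \<delta>)"
  have t: "0 \<le> t" "t \<le> 1" "t * (s - R + \<delta>) = \<delta>" "t * (3 * s) \<le> \<epsilon>"
  proof -
    show "0 \<le> t" "t \<le> 1" "t * (s - R + \<delta>) = \<delta>"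
      using \<delta> R by (auto simp: t_def)
    have "\<epsilon> * (s - R) \<le> \<epsilon> * (s - R + \<delta>)"
      using \<delta> assms(6) by simp
    then show "t * (3 * s) \<le> \<epsilon>"
      using \<delta> R by (simp add: t_def pos_divide_le_eq)
  qed
  have "\<exists>w\<in>V. radius_at w G \<le> s \<and> norm (v - w) \<le> \<epsilon>"
    if v: "v \<in> V" "radius_at v G \<le> s + \<delta>" for v
  proof (intro bexI conjI)
    let ?w = "(1 - t) *\<^sub>R v + t *\<^sub>R c"
    show "?w \<in> V"
      using assms(1) v cV t by (simp add: convexD)
    have "radius_at ?w G \<le> (1 - t) * radius_at v G + t * R"
      using radius_at_convex_combination[OF G t(1,2), of v c] cR by simp
    also have "\<dots> \<le> (1 - t) * (s + \<delta>) + t * R"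
      using v t by (intro add_right_mono mult_left_mono) auto
    also have "\<dots> = s + \<delta> - t * (s - R + \<delta>)"
      by (simp add: algebra_simps)
    finally show "radius_at ?w G \<le> s"
      using t(3) by simp
    obtain z where z: "z \<in> G"
      using G by blast
    have "norm (v - c) \<le> norm (v - z) + norm (c - z)"
      using norm_triangle_ineq4[of "v - z" "c - z"] by simp
    also have "\<dots> \<le> 3 * s"
      using norm_diff_le_radius_at[OF G(2) z, of v] norm_diff_le_radius_at[OF G(2) z, of c]
        v \<delta> R cR by linarith
    finally have "t * norm (v - c) \<le> t * (3 * s)"
      using t by (intro mult_left_mono)
    moreover have "v - ?w = t *\<^sub>R (v - c)"
      by (simp add: algebra_simps)
    ultimately show "norm (v - ?w) \<le> \<epsilon>"
      using t by simp
  qed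
  then show ?thesis
    using \<delta>(1) by blast
qed

lemma mem_cent_plus_ball:
  assumes "w \<in> C" and "norm (v - w) \<le> \<epsilon>" and "0 < \<epsilon>"
  shows "v \<in> {c + \<epsilon> *\<^sub>R b | c b. c \<in> C \<and> b \<in> unit_ball UNIV}"
proof -
  define b where "b = (1 / \<epsilon>) *\<^sub>R (v - w)"
  have "v = w + \<epsilon> *\<^sub>R b"
    using assms(3) by (simp add: b_def)
  moreover have "norm b = norm (v - w) / \<epsilon>"
    using assms(3) unfolding b_def norm_scaleR by simp
  then have "b \<in> unit_ball UNIV"
    using assms(2,3) by (simp add: unit_ball_def)
  ultimately show ?thesis
    using assms(1) by blast
qed

text \<open>Taking the maximum with a constant commutes with the infimum; evaluating at the center
  \<open>c\<close>, where the infimum for \<open>G\<close> is attained, gives the upper bound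
  directly.\<close>

lemma rad_max:
  assumes G: "G \<noteq> {}" "bounded G" and F: "F \<noteq> {}" "bounded F"
    and c: "c \<in> cent V G"
    and max: "\<And>v. v \<in> V \<Longrightarrow> radius_at v F = max (radius_at v G) s"
  shows "rad V F = max (rad V G) s"
proof (rule antisym)
  have cV: "c \<in> V" and cR: "radius_at c G = rad V G"
    using c by (auto simp: cent_def)
  show "rad V F \<le> max (rad V G) s"
    using rad_le_radius_at[OF F cV] max[OF cV] cR by simp
  have "max (rad V G) s \<le> radius_at v F" if "v \<in> V" for v
    using rad_le_radius_at[OF G that] max[OF that] by auto
  then show "max (rad V G) s \<le> rad V F"
    unfolding rad_def[of V F] using cV by (intro cINF_greatest) auto
qed

text \<open>\<open>P\<close> fixes \<open>v\<close>, so \<open>v - z\<close> has the components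
  \<open>v - P z\<close> and \<open>P z - z\<close>, the second independent of \<open>v\<close>. The
  supremum of a pointwise maximum is the maximum of the suprema.\<close>

lemma M_projection_radius_at:
  assumes P: "linear P" "P \<circ> P = P" "range P = Y"
    and norm_P: "\<And>x. norm x = max (norm (P x)) (norm (x - P x))"
    and F: "F \<noteq> {}" "bounded F" and "v \<in> Y"
  shows "radius_at v F = max (radius_at v (P ` F)) (SUP z\<in>F. norm (z - P z))"
proof -
  have Pv: "P v = v"
    using P(2,3) assms(7) by (metis comp_apply imageE)
  have bP: "bounded (P ` F)" and bQ: "bdd_above ((\<lambda>z. norm (z - P z)) ` F)"
  proof -
    obtain B where B: "\<And>z. z \<in> F \<Longrightarrow> norm z \<le> B"
      using F(2) by (auto simp: bounded_iff)
    then have le_B: "norm (P z) \<le> B \<and> norm (z - P z) \<le> B" if "z \<in> F" for z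
      using norm_P[of z] that by (metis max.bounded_iff)
    show "bounded (P ` F)"
      using le_B by (intro boundedI[where B = B]) auto
    show "bdd_above ((\<lambda>z. norm (z - P z)) ` F)"
      using le_B by (intro bdd_aboveI2[where M = B]) auto
  qed
  have dist_P: "norm (v - z) = max (norm (v - P z)) (norm (z - P z))" for z
    using norm_P[of "v - z"] Pv
    by (simp add: linear_diff[OF P(1)] norm_minus_commute)
  have "radius_at v F \<le> a \<longleftrightarrow> max (radius_at v (P ` F)) (SUP z\<in>F. norm (z - P z)) \<le> a" for a
  proof -
    have "radius_at v F \<le> a \<longleftrightarrow> (\<forall>z\<in>F. norm (v - z) \<le> a)"
      using F by (auto simp: radius_at_le_iff dist_norm)
    also have "\<dots> \<longleftrightarrow> (\<forall>z\<in>F. norm (v - P z) \<le> a) \<and> (\<forall>z\<in>F. norm (z - P z) \<le> a)"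
      by (subst dist_P) auto
    also have "\<dots> \<longleftrightarrow> max (radius_at v (P ` F)) (SUP z\<in>F. norm (z - P z)) \<le> a"
      using F bP bQ by (auto simp: radius_at_le_iff cSUP_le_iff dist_norm)
    finally show ?thesis .
  qed
  then show ?thesis
    by (meson order.antisym order.refl)
qed

theorem proposition5p1:
  fixes Y Z :: "'a::banach set"
  assumes "M_summand Y"
    and "closed_subspace Z"
    and "Z \<subseteq> Y"
    and "property_P1 Y Z (CB Y)"
  shows "property_P1 UNIV Z (CB (UNIV :: 'a set))"
proof -
  obtain P where P: "linear P" "P \<circ> P = P" "range P = Y"
    and norm_P: "\<And>x. norm x = max (norm (P x)) (norm (x - P x))"
    using assms(1) unfolding M_summand_def by blast
  have "closed Y"
    using assms(1) by (simp add: M_summand_def closed_subspace_def)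
  have "convex Z"
    using assms(2) by (simp add: closed_subspace_def subspace_imp_convex)
  have main: "cent Z F \<noteq> {} \<and> (\<forall>\<epsilon>>0. \<exists>\<delta>>0.
      near_cent Z F \<delta> \<subseteq> {c + \<epsilon> *\<^sub>R b | c b. c \<in> cent Z F \<and> b \<in> unit_ball UNIV})"
    if "F \<in> CB UNIV" for F
  proof -
    have F: "F \<noteq> {}" "bounded F"
      using that by (auto simp: CB_def)
    define G where "G = closure (P ` F)"
    define s where "s = (SUP z\<in>F. norm (z - P z))"
    have "norm (P x) \<le> norm x" for x
      using norm_P[of x] by linarith
    then have PF: "P ` F \<noteq> {}" "bounded (P ` F)"
      using F by (auto simp: bounded_iff) (meson order_trans)
    then have G: "G \<noteq> {}" "bounded G"
      by (auto simp: G_def)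
    have "G \<subseteq> Y"
      unfolding G_def using P(3) \<open>closed Y\<close> by (intro closure_minimal) auto
    then have GCB: "G \<in> CB Y"
      using G by (simp add: CB_def G_def)
    then obtain c where c: "c \<in> cent Z G"
      using assms(4) unfolding property_P1_def rcp_def by blast
    have radius: "radius_at v F = max (radius_at v G) s" if "v \<in> Z" for v
      using M_projection_radius_at[OF P norm_P F] that assms(3)
      by (auto simp: G_def s_def radius_at_closure[OF PF])
    have rad: "rad Z F = max (rad Z G) s"
      by (rule rad_max[OF G F c radius])
    \<comment> \<open>Since \<open>rad Z G \<le> radius_at v G\<close> on \<open>Z\<close>, the
      maxima with \<open>s\<close> agree exactly when \<open>radius_at v G\<close> is at most
      \<open>max (rad Z G) s\<close>. This describes the centers in both cases below.\<close>
    have cent: "cent Z F = {v \<in> Z. radius_at v G \<le> max (rad Z G) s}"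
    proof -
      have "radius_at v F = rad Z F \<longleftrightarrow> radius_at v G \<le> max (rad Z G) s" if "v \<in> Z" for v
        using radius[OF that] rad rad_le_radius_at[OF G that] by linarith
      then show ?thesis
        unfolding cent_def by blast
    qed
    have "c \<in> cent Z F"
      using c unfolding cent by (auto simp: cent_def)
    moreover have "\<exists>\<delta>>0. near_cent Z F \<delta> \<subseteq>
        {c + \<epsilon> *\<^sub>R b | c b. c \<in> cent Z F \<and> b \<in> unit_ball UNIV}"
      if \<epsilon>: "0 < \<epsilon>" for \<epsilon>
    proof (cases "s \<le> rad Z G")
      case True
      \<comment> \<open>Here \<open>rad Z F = rad Z G\<close>, so the \<open>\<delta>\<close> that
        property-(P1) in \<open>Y\<close> gives for \<open>G\<close> also serves for
        \<open>F\<close>.\<close>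
      have "cent Z G \<subseteq> cent Z F"
        unfolding cent by (auto simp: cent_def)
      moreover have "near_cent Z F \<delta> \<subseteq> near_cent Z G \<delta>" for \<delta>
        using True by (auto simp: near_cent_def rad radius)
      moreover obtain \<delta> where "\<delta> > 0"
        and "near_cent Z G \<delta> \<subseteq> {c + \<epsilon> *\<^sub>R b | c b. c \<in> cent Z G \<and> b \<in> unit_ball Y}"
        using assms(4) GCB \<epsilon> unfolding property_P1_def by blast
      moreover have "unit_ball Y \<subseteq> unit_ball UNIV"
        by (auto simp: unit_ball_def)
      ultimately show ?thesis
        by blast
    next
      case False
      \<comment> \<open>Here \<open>rad Z F = s\<close>: the centers of \<open>F\<close> form the
        sublevel set at height \<open>s\<close>, and its near-centers lie in the one at height
        \<open>s + \<delta>\<close>.\<close>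
      then obtain \<delta> where "\<delta> > 0" and \<delta>: "\<And>v. v \<in> Z \<Longrightarrow> radius_at v G \<le> s + \<delta> \<Longrightarrow>
          \<exists>w\<in>Z. radius_at w G \<le> s \<and> norm (v - w) \<le> \<epsilon>"
        using sublevel_radius_at_continuous[OF \<open>convex Z\<close> G c, of s \<epsilon>] \<epsilon> by auto
      have "v \<in> {c + \<epsilon> *\<^sub>R b | c b. c \<in> cent Z F \<and> b \<in> unit_ball UNIV}"
        if "v \<in> near_cent Z F \<delta>" for v
      proof -
        have "v \<in> Z" "radius_at v G \<le> s + \<delta>"
          using that False by (auto simp: near_cent_def rad radius)
        then obtain w where "w \<in> Z" "radius_at w G \<le> s" "norm (v - w) \<le> \<epsilon>"
          using \<delta> by blast
        then show ?thesis
          using \<epsilon> by (intro mem_cent_plus_ball[of w]) (auto simp: cent)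
      qed
      then show ?thesis
        using \<open>\<delta> > 0\<close> by blast
    qed
    ultimately show ?thesis
      by blast
  qed
  then show ?thesis
    unfolding property_P1_def rcp_def by blast
qed

end
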